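(* Let $\theta\in\mathbb{R}$ with $|\theta|<\pi/2$ and let $\gamma>0$. If $f=h+\overline{g}\in\mathcal{HC}_\theta(\gamma)$, then the pre-Schwarzian norm of $f$ satisfies $$\Vert P_f\Vert\le 1+2\gamma\cos\theta,$$ and the estimate is best possible whenever $\theta=0$, i.e. for each $\gamma>0$ the constant $1+2\gamma$ cannot be replaced by a smaller constant valid for all $f\in\mathcal{HC}_0(\gamma)$.
   Context: $\mathbb{D}=\{z\in\mathbb{C}:|z|<1\}$. $\operatorname{Aut}(\mathbb{D})=\{e^{i\phi}\frac{z-\alpha}{1-\overline{\alpha}z}:\alpha\in\mathbb{D},\ \phi\in\mathbb{R}\}$ is the set of automorphisms of $\mathbb{D}$. $\mathcal{H}$ is the class of harmonic mappings $f=h+\overline{g}$ in $\mathbb{D}$, with $h,g$ analytic in $\mathbb{D}$ and $h(0)=h'(0)-1=g(0)=0$. For $|\theta|<\pi/2$ and $\gamma>0$, $\mathcal{HC}_\theta(\gamma)$ is the class of all $f=h+\overline{g}\in\mathcal{H}$ (with $h'$ non-vanishing in $\mathbb{D}$) such that $$\operatorname{Re}\left(e^{i\theta}\left(1+\frac{zh''(z)}{h'(z)}\right)\right)<\left(1+\frac{\gamma}{2}\right)\cos\theta\quad\text{for all } z\in\mathbb{D}$$ and the dilatation $\omega=g'/h'$ belongs to $\operatorname{Aut}(\mathbb{D})$. The pre-Schwarzian derivative of such $f$ is $$P_f=(\log J_f)_z=\frac{h''}{h'}-\frac{\overline{\omega}\,\omega'}{1-|\omega|^2},\qquad J_f=|h'|^2-|g'|^2,$$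 and the pre-Schwarzian norm is $\Vert P_f\Vert=\sup_{z\in\mathbb{D}}(1-|z|^2)|P_f(z)|$. *)

theory Defs
  imports "HOL-Complex_Analysis.Complex_Analysis"
begin

abbreviation unit_disc :: "complex set" where
  "unit_disc \<equiv> ball 0 1"

definition wirtinger_z :: "(complex \<Rightarrow> complex) \<Rightarrow> complex \<Rightarrow> complex" where
  "wirtinger_z F z =
     (frechet_derivative F (at z) 1 - \<i> * frechet_derivative F (at z) \<i>) / 2"

definition wirtinger_zbar :: "(complex \<Rightarrow> complex) \<Rightarrow> complex \<Rightarrow> complex" where
  "wirtinger_zbar F z =
     (frechet_derivative F (at z) 1 + \<i> * frechet_derivative F (at z) \<i>) / 2"

text \<open>For \<open>f = h + cnj g\<close> with \<open>h\<close>, \<open>g\<close> analytic, the Jacobian below is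
  \<open>\<bar>h'\<bar>\<^sup>2 - \<bar>g'\<bar>\<^sup>2\<close>; see \<open>real_jacobian_harmonic\<close>.\<close>

definition real_jacobian :: "(complex \<Rightarrow> complex) \<Rightarrow> complex \<Rightarrow> real" where
  "real_jacobian f z = (cmod (wirtinger_z f z))\<^sup>2 - (cmod (wirtinger_zbar f z))\<^sup>2"

definition pre_schwarzian :: "(complex \<Rightarrow> complex) \<Rightarrow> complex \<Rightarrow> complex" where
  "pre_schwarzian f z = wirtinger_z (\<lambda>w. complex_of_real (ln (real_jacobian f w))) z"

text \<open>The supremum is taken in the extended reals, so that a bound on the norm
  includes its finiteness.\<close>

definition pre_schwarzian_norm :: "(complex \<Rightarrow> complex) \<Rightarrow> ereal" where
  "pre_schwarzian_norm f =
     (SUP z\<in>unit_disc. ereal ((1 - (cmod z)\<^sup>2) * cmod (pre_schwarzian f z)))"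

text \<open>\<open>harmonic_rep f h g\<close>: on the disc \<open>f\<close> is a normalized harmonic mapping with
  analytic part \<open>h\<close> and co-analytic part \<open>g\<close>. Values off the disc are irrelevant.\<close>

definition harmonic_rep ::
    "(complex \<Rightarrow> complex) \<Rightarrow> (complex \<Rightarrow> complex) \<Rightarrow> (complex \<Rightarrow> complex) \<Rightarrow> bool" where
  "harmonic_rep f h g \<longleftrightarrow>
     h holomorphic_on unit_disc \<and> g holomorphic_on unit_disc \<and>
     h 0 = 0 \<and> deriv h 0 = 1 \<and> g 0 = 0 \<and>
     (\<forall>z\<in>unit_disc. f z = h z + cnj (g z))"

definition dilatation :: "(complex \<Rightarrow> complex) \<Rightarrow> (complex \<Rightarrow> complex) \<Rightarrow> complex \<Rightarrow> complex" where
  "dilatation h g z = deriv g z / deriv h z"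

definition disc_automorphism :: "(complex \<Rightarrow> complex) \<Rightarrow> bool" where
  "disc_automorphism \<omega> \<longleftrightarrow>
     (\<exists>\<phi> \<alpha>. \<alpha> \<in> unit_disc \<and> (\<forall>z\<in>unit_disc. \<omega> z = Moebius_function \<phi> \<alpha> z))"

definition HC :: "real \<Rightarrow> real \<Rightarrow> (complex \<Rightarrow> complex) set" where
  "HC \<theta> \<gamma> = {f. \<exists>h g. harmonic_rep f h g \<and>
     (\<forall>z\<in>unit_disc. deriv h z \<noteq> 0) \<and>
     (\<forall>z\<in>unit_disc.
        Re (exp (\<i> * complex_of_real \<theta>) * (1 + z * deriv (deriv h) z / deriv h z))
          < (1 + \<gamma> / 2) * cos \<theta>) \<and>
     disc_automorphism (dilatation h g)}"

lemma wirtinger_harmonic: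
  assumes f: "harmonic_rep f h g" and z: "z \<in> unit_disc"
  shows "wirtinger_z f z = deriv h z" and "wirtinger_zbar f z = cnj (deriv g z)"
proof -
  have h: "(h has_field_derivative deriv h z) (at z)"
    and g: "(g has_field_derivative deriv g z) (at z)"
    using f z unfolding harmonic_rep_def
    by (auto intro!: holomorphic_derivI[of _ "ball 0 1"])
  have "((\<lambda>w. h w + cnj (g w)) has_derivative
          (\<lambda>t. deriv h z * t + cnj (deriv g z * t))) (at z)"
    using h g unfolding has_field_derivative_def
    by (intro derivative_intros has_derivative_cnj) auto
  then have "(f has_derivative (\<lambda>t. deriv h z * t + cnj (deriv g z * t))) (at z)"
    by (rule has_derivative_transform_within_open[where s = "ball 0 1"])
      (use f z in \<open>auto simp: harmonic_rep_def\<close>)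
  then have "frechet_derivative f (at z) = (\<lambda>t. deriv h z * t + cnj (deriv g z * t))"
    using frechet_derivative_at by force
  then show "wirtinger_z f z = deriv h z" "wirtinger_zbar f z = cnj (deriv g z)"
    by (simp_all add: wirtinger_z_def wirtinger_zbar_def algebra_simps)
qed

lemma real_jacobian_harmonic:
  assumes "harmonic_rep f h g" and "z \<in> unit_disc"
  shows "real_jacobian f z = (cmod (deriv h z))\<^sup>2 - (cmod (deriv g z))\<^sup>2"
  using wirtinger_harmonic[OF assms] by (simp add: real_jacobian_def)

lemma pre_schwarzian_harmonic:
  assumes f: "harmonic_rep f h g" and z: "z \<in> unit_disc"
    and h0: "deriv h z \<noteq> 0" and w1: "cmod (dilatation h g z) < 1"
  shows "pre_schwarzian f z =
    deriv (deriv h) z / deriv h z -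
    cnj (dilatation h g z) * deriv (dilatation h g) z /
      complex_of_real (1 - (cmod (dilatation h g z))\<^sup>2)"
proof -
  define a a2 b b2 where "a = deriv h z" and "a2 = deriv (deriv h) z"
    and "b = deriv g z" and "b2 = deriv (deriv g) z"
  have h': "(deriv h has_field_derivative a2) (at z)"
    and g': "(deriv g has_field_derivative b2) (at z)"
    using f z unfolding harmonic_rep_def a2_def b2_def
    by (auto intro!: holomorphic_derivI[of _ "ball 0 1"] holomorphic_deriv)
  define N where "N = (\<lambda>w. Re (deriv h w * cnj (deriv h w) - deriv g w * cnj (deriv g w)))"
  have N: "N w = (cmod (deriv h w))\<^sup>2 - (cmod (deriv g w))\<^sup>2" for w
    unfolding N_def by (simp only: complex_norm_square[symmetric] minus_complex.simps Re_complex_of_real flip: of_real_power)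
  have a0: "a \<noteq> 0" and ba: "cmod b < cmod a"
    using h0 w1 by (auto simp: a_def b_def dilatation_def norm_divide field_simps)
  have pos: "N z > 0"
    using ba by (auto simp: N a_def b_def intro!: power_strict_mono)
  define D where "D = (\<lambda>t. Re (a * cnj (a2 * t) + a2 * t * cnj a - (b * cnj (b2 * t) + b2 * t * cnj b)))"
  have dN: "(N has_derivative D) (at z)"
    using h' g' unfolding N_def D_def a_def b_def has_field_derivative_def
    by (intro derivative_intros has_derivative_cnj has_derivative_Re) auto
  have "((\<lambda>w. complex_of_real (ln (N w))) has_derivative (\<lambda>t. complex_of_real (D t * inverse (N z)))) (at z)"
    using dN pos
    by (intro has_derivative_of_real has_derivative_ln) auto
  then have "((\<lambda>w. complex_of_real (ln (real_jacobian f w))) has_derivative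
      (\<lambda>t. complex_of_real (D t * inverse (N z)))) (at z)"
    by (rule has_derivative_transform_within_open[where s = "ball 0 1"])
      (use z real_jacobian_harmonic[OF f] in \<open>auto simp: N\<close>)
  then have "frechet_derivative (\<lambda>w. complex_of_real (ln (real_jacobian f w))) (at z) =
      (\<lambda>t. complex_of_real (D t * inverse (N z)))"
    using frechet_derivative_at by force
  then have "pre_schwarzian f z =
      (complex_of_real (D 1) - \<i> * complex_of_real (D \<i>)) / (2 * complex_of_real (N z))"
    using pos by (simp add: pre_schwarzian_def wirtinger_z_def divide_simps)
  also have "complex_of_real (D 1) - \<i> * complex_of_real (D \<i>) = 2 * (a2 * cnj a - b2 * cnj b)"
    by (simp add: D_def complex_eq_iff algebra_simps)
  finally have P: "pre_schwarzian f z = (a2 * cnj a - b2 * cnj b) / complex_of_real (N z)"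
    by (simp only: mult_divide_mult_cancel_left_if) simp
  have "(dilatation h g has_field_derivative (b2 * a - b * a2) / (a * a)) (at z)"
    using DERIV_divide[OF g' h'] h0 unfolding dilatation_def a_def b_def by simp
  then have dw: "deriv (dilatation h g) z = (b2 * a - b * a2) / (a * a)"
    by (rule DERIV_imp_deriv)
  have Nz: "complex_of_real (N z) = a * cnj a - b * cnj b"
    by (simp add: N a_def b_def complex_norm_square[symmetric])
  have W: "complex_of_real (1 - (cmod (dilatation h g z))\<^sup>2) = (a * cnj a - b * cnj b) / (a * cnj a)"
    using a0 by (simp add: complex_norm_square dilatation_def a_def b_def field_simps del: of_real_power)
  have nz: "a * cnj a - b * cnj b \<noteq> 0"
    using pos Nz by (metis less_irrefl of_real_eq_0_iff)
  define E where "E = a * cnj a - b * cnj b"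
  have E: "E \<noteq> 0" and ca: "cnj a \<noteq> 0"
    using nz a0 by (auto simp: E_def)
  have "cnj (b / a) * ((b2 * a - b * a2) / (a * a)) / (E / (a * cnj a)) =
      cnj b * (b2 * a - b * a2) / (a * E)"
    using a0 ca E by (simp add: field_simps)
  moreover have "a2 / a - cnj b * (b2 * a - b * a2) / (a * E) =
      (a2 * E - cnj b * (b2 * a - b * a2)) / (a * E)"
    using a0 E by (simp add: diff_divide_distrib)
  moreover have "a2 * E - cnj b * (b2 * a - b * a2) = a * (a2 * cnj a - b2 * cnj b)"
    by (simp add: E_def algebra_simps)
  ultimately have "(a2 * cnj a - b2 * cnj b) / E =
      a2 / a - cnj (b / a) * ((b2 * a - b * a2) / (a * a)) / (E / (a * cnj a))"
    using a0 by simp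
  then show ?thesis
    unfolding P W dw Nz
    by (simp add: E_def dilatation_def a_def a2_def b_def)
qed

end

theory Submission imports Defs begin

text \<open>
  The pre-Schwarzian derivative is \<open>h''/h'\<close> minus \<open>cnj \<omega> \<omega>' / (1 - \<bar>\<omega>\<bar>\<^sup>2)\<close>, and
  the two terms are estimated separately. Equality holds in the Schwarz--Pick lemma for an
  automorphism \<open>\<omega>\<close>, so the second term contributes \<open>\<bar>\<omega>\<bar> < 1\<close>. The function
  \<open>e\<^sup>i\<^sup>\<theta> z h''/h'\<close> vanishes at \<open>0\<close> and maps the disc into the half-plane
  \<open>Re < c\<close> with \<open>c = \<gamma> cos \<theta> / 2\<close>, so the Schwarz lemma gives
  \<open>\<bar>h''/h'\<bar> \<le> 2 c / (1 - \<bar>z\<bar>)\<close>, and the first term contributes at most \<open>4 c\<close>.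
  For \<open>\<theta> = 0\<close>, the mapping with \<open>h' = (1 - z)\<^sup>\<gamma>\<close> and \<open>\<omega>(z) = z\<close> yields
  \<open>\<gamma> (1 + r) + r\<close> at \<open>z = r\<close>, which tends to \<open>1 + 2 \<gamma>\<close> as \<open>r\<close> tends to \<open>1\<close>.
\<close>

section \<open>Schwarz lemma for maps into a half-plane\<close>

text \<open>The line \<open>Re p = c\<close> is the perpendicular bisector of the segment from 0 to
  2c, so being closer to 0 than to 2c means lying to its left.\<close>

lemma cmod_less_cmod_diff_iff:
  fixes c :: real
  assumes "c > 0"
  shows "cmod p < cmod (p - of_real (2 * c)) \<longleftrightarrow> Re p < c"
proof -
  have "(cmod (p - of_real (2 * c)))\<^sup>2 - (cmod p)\<^sup>2 = 4 * c * (c - Re p)"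
    unfolding cmod_power2 by (simp add: power2_eq_square algebra_simps)
  moreover have "4 * c * (c - Re p) > 0 \<longleftrightarrow> Re p < c"
    using assms by (simp add: zero_less_mult_iff)
  moreover have "cmod p < cmod (p - of_real (2 * c)) \<longleftrightarrow>
      (cmod p)\<^sup>2 < (cmod (p - of_real (2 * c)))\<^sup>2"
    by (simp add: abs_le_square_iff flip: not_le)
  ultimately show ?thesis
    by linarith
qed

text \<open>The map p -> p / (p - 2c) fixes 0 and takes the half-plane Re p < c into the unit disc,
  so the Schwarz lemma applies to its composition with w F(w). Stating the bound for F rather than
  for w F(w) avoids a division by 0 at the origin.\<close>

lemma Schwarz_half_plane:
  fixes F :: "complex \<Rightarrow> complex" and c :: real
  assumes F: "F holomorphic_on ball 0 1" and c: "c > 0"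
    and Re: "\<And>w. w \<in> ball 0 1 \<Longrightarrow> Re (w * F w) < c"
    and z: "z \<in> ball 0 1"
  shows "cmod (F z) \<le> 2 * c / (1 - cmod z)"
proof -
  \<comment> \<open>\<open>w * v w\<close> is the disc-valued composition; \<open>v\<close> is that
    function with its zero at the origin divided out.\<close>
  define v where "v = (\<lambda>w. F w / (w * F w - of_real (2 * c)))"
  have nz: "w * F w - of_real (2 * c) \<noteq> 0" if "w \<in> ball 0 1" for w
  proof
    assume "w * F w - of_real (2 * c) = 0"
    then have "Re (w * F w) = 2 * c"
      by (metis Re_complex_of_real eq_iff_diff_eq_0)
    with Re[OF that] c show False by simp
  qed
  have v: "v holomorphic_on ball 0 1"
    unfolding v_def using F nz by (intro holomorphic_intros) auto
  have u: "(\<lambda>w. w * v w) holomorphic_on ball 0 1"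
    using v by (intro holomorphic_intros)
  have u1: "cmod (w * v w) < 1" if "cmod w < 1" for w
  proof -
    have w: "w \<in> ball 0 1" using that by simp
    have "cmod (w * F w) < cmod (w * F w - of_real (2 * c))"
      using Re[OF w] c by (simp only: cmod_less_cmod_diff_iff)
    moreover have "w * v w = (w * F w) / (w * F w - of_real (2 * c))"
      by (simp add: v_def)
    ultimately show ?thesis
      using nz[OF w] by (simp only: norm_divide) (simp add: divide_less_eq)
  qed
  have v1: "cmod (v z) \<le> 1"
  \<comment> \<open>At 0 the derivative part of the Schwarz lemma is needed, since
    \<open>v 0\<close> is the derivative of \<open>w * v w\<close> there; elsewhere the growth part
    is divided by |z|.\<close>
  proof (cases "z = 0")
    case True
    have "v field_differentiable at 0"
      using v by (rule holomorphic_on_imp_differentiable_at) auto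
    then have "(v has_field_derivative deriv v 0) (at 0)"
      by (simp add: DERIV_deriv_iff_field_differentiable)
    then have "((\<lambda>w. w * v w) has_field_derivative v 0) (at 0)"
      by (auto intro!: derivative_eq_intros)
    then have "deriv (\<lambda>w. w * v w) 0 = v 0"
      by (rule DERIV_imp_deriv)
    with Schwarz_Lemma(2)[OF u _ u1, of 0] True show ?thesis by simp
  next
    case False
    with Schwarz_Lemma(1)[OF u _ u1, of z] z show ?thesis
      by (simp add: norm_mult)
  qed
  have z1: "cmod z < 1" using z by simp
  \<comment> \<open>The definition of \<open>v\<close> is solved for \<open>F\<close>: F (1 - z v) =
    -2c v. With |v| <= 1 this leaves only a lower bound for |1 - z v| to be found.\<close>
  have "F z = v z * (z * F z - of_real (2 * c))"
    using nz[OF z] by (simp add: v_def)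
  then have "F z * (1 - z * v z) = - (of_real (2 * c) * v z)"
    by (simp add: algebra_simps)
  then have "cmod (F z) * cmod (1 - z * v z) = 2 * c * cmod (v z)"
    using c by (metis norm_minus_cancel norm_mult norm_of_real abs_of_pos mult_pos_pos zero_less_numeral)
  also have "\<dots> \<le> 2 * c"
    using c v1 by simp
  finally have "cmod (F z) * cmod (1 - z * v z) \<le> 2 * c" .
  moreover have "1 - cmod z \<le> cmod (1 - z * v z)"
  proof -
    have "cmod (z * v z) \<le> cmod z"
      using v1 by (simp add: norm_mult mult_left_le)
    then show ?thesis
      using norm_triangle_ineq2[of 1 "z * v z"] by simp
  qed
  then have "cmod (F z) * (1 - cmod z) \<le> cmod (F z) * cmod (1 - z * v z)"
    by (intro mult_left_mono) auto
  ultimately have "cmod (F z) * (1 - cmod z) \<le> 2 * c" by linarith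
  then show ?thesis
    using z1 by (simp add: le_divide_eq)
qed

section \<open>Equality in Schwarz-Pick for disc automorphisms\<close>

lemma Moebius_denominator_nonzero:
  fixes w z :: complex
  assumes "cmod w < 1" "cmod z < 1"
  shows "1 - cnj w * z \<noteq> 0"
proof
  assume "1 - cnj w * z = 0"
  then have "cmod w * cmod z = 1"
    by (metis complex_mod_cnj eq_iff_diff_eq_0 norm_mult norm_one)
  then show False
    using assms mult_strict_mono[of "cmod w" 1 "cmod z" 1] by simp
qed

lemma one_minus_norm_Moebius_function:
  assumes "cmod w < 1" "cmod z < 1"
  shows "1 - (cmod (Moebius_function t w z))\<^sup>2 =
    (1 - (cmod w)\<^sup>2) * (1 - (cmod z)\<^sup>2) / (cmod (1 - cnj w * z))\<^sup>2"
proof -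
  have "(cmod (1 - cnj w * z))\<^sup>2 - (cmod (z - w))\<^sup>2 = (1 - (cmod w)\<^sup>2) * (1 - (cmod z)\<^sup>2)"
    unfolding cmod_power2 by (simp add: power2_eq_square algebra_simps)
  then show ?thesis
    using Moebius_denominator_nonzero[OF assms]
    by (simp add: Moebius_function_def norm_mult norm_divide power_divide diff_divide_eq_iff)
qed

text \<open>The quotient rule leaves the constant numerator 1 - |w|^2, up to a rotation of modulus
  1. Multiplied by 1 - |z|^2, this is the right-hand side of
  \<open>one_minus_norm_Moebius_function\<close>.\<close>

lemma norm_deriv_Moebius_function:
  assumes "cmod w < 1" "cmod z < 1"
  shows "cmod (deriv (Moebius_function t w) z) = (1 - (cmod w)\<^sup>2) / (cmod (1 - cnj w * z))\<^sup>2"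
proof -
  note nz = Moebius_denominator_nonzero[OF assms]
  have "(Moebius_function t w has_field_derivative
      exp (\<i> * of_real t) * (1 - w * cnj w) / (1 - cnj w * z)\<^sup>2) (at z)"
    unfolding Moebius_function_def using nz
    by (auto intro!: derivative_eq_intros simp: power2_eq_square algebra_simps)
  then have "deriv (Moebius_function t w) z =
      exp (\<i> * of_real t) * (1 - w * cnj w) / (1 - cnj w * z)\<^sup>2"
    by (rule DERIV_imp_deriv)
  moreover have "cmod (1 - w * cnj w) = 1 - (cmod w)\<^sup>2"
  proof -
    have "1 - w * cnj w = of_real (1 - (cmod w)\<^sup>2)"
      by (simp add: complex_norm_square del: of_real_power)
    moreover have "1 - (cmod w)\<^sup>2 \<ge> 0"
      using assms by (simp add: power_le_one)
    ultimately show ?thesis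
      by (simp only: norm_of_real abs_of_nonneg)
  qed
  ultimately show ?thesis
    by (simp add: norm_mult norm_divide norm_power)
qed

lemma disc_automorphism_Schwarz_Pick:
  assumes "disc_automorphism \<omega>" and z: "z \<in> unit_disc"
  shows "cmod (\<omega> z) < 1"
    and "(1 - (cmod z)\<^sup>2) * cmod (deriv \<omega> z) = 1 - (cmod (\<omega> z))\<^sup>2"
proof -
  obtain t \<alpha> where \<alpha>: "\<alpha> \<in> unit_disc" and \<omega>: "\<forall>z\<in>unit_disc. \<omega> z = Moebius_function t \<alpha> z"
    using assms(1) unfolding disc_automorphism_def by blast
  \<comment> \<open>\<open>\<omega>\<close> agrees with a Moebius function only on the disc, so
    derivatives are compared through a neighbourhood of \<open>z\<close>.\<close>
  have "eventually (\<lambda>x. x \<in> unit_disc) (nhds z)"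
    using z by (intro eventually_nhds_in_open) auto
  then have "eventually (\<lambda>x. \<omega> x = Moebius_function t \<alpha> x) (nhds z)"
    by eventually_elim (use \<omega> in auto)
  then have d: "deriv \<omega> z = deriv (Moebius_function t \<alpha>) z"
    by (rule deriv_cong_ev) simp
  show "cmod (\<omega> z) < 1"
    using \<omega> \<alpha> z by (simp add: Moebius_function_norm_lt_1)
  show "(1 - (cmod z)\<^sup>2) * cmod (deriv \<omega> z) = 1 - (cmod (\<omega> z))\<^sup>2"
    using \<omega> \<alpha> z by (simp add: d norm_deriv_Moebius_function one_minus_norm_Moebius_function)
qed

section \<open>The upper bound\<close>

lemma pre_schwarzian_norm_le:
  fixes \<theta> \<gamma> :: real
  assumes "\<bar>\<theta>\<bar> < pi / 2" and "\<gamma> > 0" and f: "f \<in> HC \<theta> \<gamma>"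
  shows "pre_schwarzian_norm f \<le> ereal (1 + 2 * \<gamma> * cos \<theta>)"
  unfolding pre_schwarzian_norm_def
proof (rule SUP_least)
  fix z :: complex assume z: "z \<in> unit_disc"
  obtain h g where rep: "harmonic_rep f h g"
    and h0: "\<And>z. z \<in> unit_disc \<Longrightarrow> deriv h z \<noteq> 0"
    and Re: "\<And>z. z \<in> unit_disc \<Longrightarrow>
        Re (exp (\<i> * of_real \<theta>) * (1 + z * deriv (deriv h) z / deriv h z)) < (1 + \<gamma> / 2) * cos \<theta>"
    and aut: "disc_automorphism (dilatation h g)"
    using f unfolding HC_def by blast
  define \<omega> where "\<omega> = dilatation h g"
  define c where "c = \<gamma> * cos \<theta> / 2"
  have c: "c > 0"
    using assms by (simp add: c_def cos_gt_zero_pi)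
  \<comment> \<open>Keeping the rotation inside \<open>F\<close> makes the defining inequality a
    half-plane condition: the summand 1 contributes exactly cos \<theta>, and \<open>c\<close> is
    what remains of the bound.\<close>
  define F where "F = (\<lambda>w. exp (\<i> * of_real \<theta>) * (deriv (deriv h) w / deriv h w))"
  have "h holomorphic_on unit_disc"
    using rep by (simp add: harmonic_rep_def)
  then have F: "F holomorphic_on ball 0 1"
    unfolding F_def using h0 by (intro holomorphic_intros holomorphic_deriv) auto
  have ReF: "Re (w * F w) < c" if "w \<in> ball 0 1" for w
  proof -
    have "exp (\<i> * of_real \<theta>) * (1 + w * deriv (deriv h) w / deriv h w) =
        exp (\<i> * of_real \<theta>) + w * F w"
      by (simp add: F_def algebra_simps)
    moreover have "Re (exp (\<i> * of_real \<theta>)) = cos \<theta>"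
      by (simp add: Re_exp)
    ultimately show ?thesis
      using Re[OF that] by (simp add: c_def algebra_simps)
  qed
  have z1: "cmod z < 1" using z by simp
  then have pos: "1 - (cmod z)\<^sup>2 > 0"
    by (simp add: power_less_one_iff)
  have "cmod (deriv (deriv h) z / deriv h z) = cmod (F z)"
    unfolding F_def norm_mult[of "exp _"] by simp
  also have "\<dots> \<le> 2 * c / (1 - cmod z)"
    using Schwarz_half_plane[OF F c ReF z] .
  finally have "(1 - (cmod z)\<^sup>2) * cmod (deriv (deriv h) z / deriv h z) \<le>
      (1 - (cmod z)\<^sup>2) * (2 * c / (1 - cmod z))"
    using pos by (intro mult_left_mono) auto
  \<comment> \<open>The factor 1 - |z| of 1 - |z|^2 cancels the pole of the Schwarz bound.\<close>
  also have "\<dots> = 2 * c * (1 + cmod z)"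
    using z1 by (simp add: power2_eq_square field_simps)
  also have "\<dots> \<le> 2 * c * 2"
    using z1 c by (intro mult_left_mono) auto
  finally have first: "(1 - (cmod z)\<^sup>2) * cmod (deriv (deriv h) z / deriv h z) \<le> 2 * \<gamma> * cos \<theta>"
    by (simp add: c_def)
  have \<omega>1: "cmod (\<omega> z) < 1" and SP: "(1 - (cmod z)\<^sup>2) * cmod (deriv \<omega> z) = 1 - (cmod (\<omega> z))\<^sup>2"
    using disc_automorphism_Schwarz_Pick[OF aut z] by (simp_all add: \<omega>_def)
  have pos\<omega>: "1 - (cmod (\<omega> z))\<^sup>2 > 0"
    using \<omega>1 by (simp add: power_less_one_iff)
  have norm2: "cmod (cnj (\<omega> z) * deriv \<omega> z / of_real (1 - (cmod (\<omega> z))\<^sup>2)) =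
      cmod (\<omega> z) * cmod (deriv \<omega> z) / (1 - (cmod (\<omega> z))\<^sup>2)"
    using pos\<omega> by (simp only: norm_divide norm_mult complex_mod_cnj norm_of_real abs_of_pos)
  \<comment> \<open>By \<open>SP\<close> the weight times the derivative of \<open>\<omega>\<close>
    equals the denominator, so only the factor |\<omega>(z)| survives.\<close>
  have second: "(1 - (cmod z)\<^sup>2) *
      cmod (cnj (\<omega> z) * deriv \<omega> z / of_real (1 - (cmod (\<omega> z))\<^sup>2)) = cmod (\<omega> z)"
    unfolding norm2 times_divide_eq_right mult.left_commute[of "1 - (cmod z)\<^sup>2"] SP
    using pos\<omega> by simp
  have "pre_schwarzian f z = deriv (deriv h) z / deriv h z -
      cnj (\<omega> z) * deriv \<omega> z / of_real (1 - (cmod (\<omega> z))\<^sup>2)"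
    using pre_schwarzian_harmonic[OF rep z h0[OF z]] \<omega>1 by (simp add: \<omega>_def)
  then have "cmod (pre_schwarzian f z) \<le> cmod (deriv (deriv h) z / deriv h z) +
      cmod (cnj (\<omega> z) * deriv \<omega> z / of_real (1 - (cmod (\<omega> z))\<^sup>2))"
    by (simp only: norm_triangle_ineq4)
  then have "(1 - (cmod z)\<^sup>2) * cmod (pre_schwarzian f z) \<le>
      (1 - (cmod z)\<^sup>2) * (cmod (deriv (deriv h) z / deriv h z) +
      cmod (cnj (\<omega> z) * deriv \<omega> z / of_real (1 - (cmod (\<omega> z))\<^sup>2)))"
    using pos by (intro mult_left_mono) auto
  also have "\<dots> \<le> 2 * \<gamma> * cos \<theta> + cmod (\<omega> z)"
    using first second unfolding distrib_left by linarith
  finally show "ereal ((1 - (cmod z)\<^sup>2) * cmod (pre_schwarzian f z)) \<le> ereal (1 + 2 * \<gamma> * cos \<theta>)"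
    using \<omega>1 by simp
qed

section \<open>Sharpness for \<theta> = 0\<close>

text \<open>Since |1 - z|^2 = 1 - 2 Re z + |z|^2 < 2 (1 - Re z). This yields the class condition for
  the extremal mapping, where z h''/h' = \<gamma> (1 - 1/(1 - z)).\<close>

lemma Re_inverse_one_minus_gt_half:
  assumes "cmod z < 1"
  shows "Re (1 / (1 - z)) > 1 / 2"
proof -
  have z1: "(cmod z)\<^sup>2 < 1"
    using assms by (simp add: power_less_one_iff)
  have pos: "(cmod (1 - z))\<^sup>2 > 0"
    using assms by auto
  have "(cmod (1 - z))\<^sup>2 < 2 * (1 - Re z)"
    using z1 unfolding cmod_power2 by (simp add: power2_eq_square algebra_simps)
  moreover have "Re (1 / (1 - z)) = (1 - Re z) / (cmod (1 - z))\<^sup>2"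
    by (simp add: Re_divide cmod_power2)
  ultimately show ?thesis
    using pos by (simp only: less_divide_eq) simp
qed

lemma HC_extremal:
  fixes \<gamma> :: real
  assumes "\<gamma> > 0"
  obtains f where "f \<in> HC 0 \<gamma>"
    and "\<And>r. 0 \<le> r \<Longrightarrow> r < 1 \<Longrightarrow> ereal (\<gamma> * (1 + r) + r) \<le> pre_schwarzian_norm f"
proof -
  define k where "k = (\<lambda>z::complex. (1 - z) powr of_real \<gamma>)"
  \<comment> \<open>The primitive of \<open>k\<close> that vanishes at 0. The principal power is
    holomorphic here because 1 - z has positive real part on the disc.\<close>
  define h where "h = (\<lambda>z::complex. (1 - (1 - z) powr (of_real \<gamma> + 1)) / (of_real \<gamma> + 1))"
  have \<gamma>1: "complex_of_real \<gamma> + 1 \<noteq> 0"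
    using assms by (metis add_pos_pos less_irrefl of_real_1 of_real_add of_real_eq_0_iff zero_less_one)
  have nonpos: "1 - z \<notin> \<real>\<^sub>\<le>\<^sub>0" if "z \<in> unit_disc" for z
    using that complex_Re_le_cmod[of z] by (auto simp: complex_nonpos_Reals_iff)
  have n0: "1 - z \<noteq> 0" if "z \<in> unit_disc" for z :: complex
    using that by auto
  have k0: "k z \<noteq> 0" if "z \<in> unit_disc" for z
    using n0[OF that] by (simp add: k_def)
  have dh: "(h has_field_derivative k z) (at z)" if "z \<in> unit_disc" for z
    unfolding h_def k_def using nonpos[OF that] \<gamma>1
    by (auto intro!: derivative_eq_intros)
  have dk: "(k has_field_derivative - (of_real \<gamma> / (1 - z)) * k z) (at z)" if "z \<in> unit_disc" for z
    unfolding k_def using nonpos[OF that] n0[OF that]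
    by (auto intro!: derivative_eq_intros simp: powr_diff)
  have "k holomorphic_on unit_disc"
    unfolding holomorphic_on_open[OF open_ball] using dk by blast
  then have "(\<lambda>z. z * k z) holomorphic_on unit_disc"
    by (intro holomorphic_intros)
  \<comment> \<open>The prescribed dilatation z forces g' = z k. A primitive exists because the disc
    is convex; subtracting \<open>g0 0\<close> below normalizes it.\<close>
  then obtain g0 where "\<And>z. z \<in> unit_disc \<Longrightarrow> (g0 has_field_derivative z * k z) (at z within unit_disc)"
    by (rule holomorphic_convex_primitive'[rotated 2]) auto
  then have g0: "(g0 has_field_derivative z * k z) (at z)" if "z \<in> unit_disc" for z
    using that by (metis at_within_open open_ball)
  define g where "g = (\<lambda>z. g0 z - g0 0)"
  have dg: "(g has_field_derivative z * k z) (at z)" if "z \<in> unit_disc" for z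
    unfolding g_def using g0[OF that] by (auto intro!: derivative_eq_intros)
  have h': "deriv h z = k z" and g': "deriv g z = z * k z" if "z \<in> unit_disc" for z
    using dh dg that by (auto intro: DERIV_imp_deriv)
  have h'': "deriv (deriv h) z / deriv h z = - (of_real \<gamma> / (1 - z))" if z: "z \<in> unit_disc" for z
  proof -
    have "eventually (\<lambda>x. x \<in> unit_disc) (nhds z)"
      using z by (intro eventually_nhds_in_open) auto
    then have "eventually (\<lambda>x. deriv h x = k x) (nhds z)"
      by eventually_elim (rule h')
    then have "deriv (deriv h) z = deriv k z"
      by (rule deriv_cong_ev) simp
    also have "\<dots> = - (of_real \<gamma> / (1 - z)) * k z"
      using dk[OF z] by (rule DERIV_imp_deriv)
    finally show ?thesis
      using k0[OF z] h'[OF z] by simp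
  qed
  have \<omega>: "dilatation h g z = z" if "z \<in> unit_disc" for z
    using k0[OF that] that by (simp add: dilatation_def h' g')
  have \<omega>': "deriv (dilatation h g) z = 1" if z: "z \<in> unit_disc" for z
  proof -
    have "eventually (\<lambda>x. x \<in> unit_disc) (nhds z)"
      using z by (intro eventually_nhds_in_open) auto
    then have "eventually (\<lambda>x. dilatation h g x = x) (nhds z)"
      by eventually_elim (rule \<omega>)
    then have "deriv (dilatation h g) z = deriv (\<lambda>x. x) z"
      by (rule deriv_cong_ev) simp
    then show ?thesis by simp
  qed
  define f where "f = (\<lambda>z. h z + cnj (g z))"
  have rep: "harmonic_rep f h g"
    unfolding harmonic_rep_def
  proof (intro conjI ballI)
    show "h holomorphic_on unit_disc" "g holomorphic_on unit_disc"
      unfolding holomorphic_on_open[OF open_ball] using dh dg by blast+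
    show "deriv h 0 = 1"
      by (simp add: h' k_def)
  qed (simp_all add: h_def g_def f_def)
  have Re: "Re (exp (\<i> * of_real 0) * (1 + z * deriv (deriv h) z / deriv h z)) < (1 + \<gamma> / 2) * cos 0"
    if z: "z \<in> unit_disc" for z
  proof -
    have "z * deriv (deriv h) z / deriv h z = z * (- (of_real \<gamma> / (1 - z)))"
      using h''[OF z] by (metis times_divide_eq_right)
    also have "\<dots> = of_real \<gamma> * (1 - 1 / (1 - z))"
      using n0[OF z] by (simp add: field_simps)
    finally have eq: "Re (z * deriv (deriv h) z / deriv h z) = \<gamma> * (1 - Re (1 / (1 - z)))"
      by simp
    also have "\<dots> < \<gamma> * (1 / 2)"
      using Re_inverse_one_minus_gt_half[of z] z assms by (intro mult_strict_left_mono) auto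
    finally show ?thesis by simp
  qed
  \<comment> \<open>The identity is the Moebius function with both parameters 0.\<close>
  have aut: "disc_automorphism (dilatation h g)"
    unfolding disc_automorphism_def
    by (rule exI[of _ 0], rule exI[of _ 0]) (simp add: \<omega> Moebius_function_simple)
  have hne: "deriv h z \<noteq> 0" if "z \<in> unit_disc" for z
    using h'[OF that] k0[OF that] by simp
  have HC: "f \<in> HC 0 \<gamma>"
    unfolding HC_def mem_Collect_eq using rep hne Re aut by blast
  have bound: "ereal (\<gamma> * (1 + r) + r) \<le> pre_schwarzian_norm f" if r: "0 \<le> r" "r < 1" for r :: real
  proof -
    define z where "z = complex_of_real r"
    have z: "z \<in> unit_disc" and cz: "cmod z = r"
      using r by (simp_all add: z_def)
    have r2: "1 - r\<^sup>2 > 0"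
      using r by (simp add: power_less_one_iff)
    have "cmod (dilatation h g z) < 1"
      using \<omega> z by simp
    then have "pre_schwarzian f z = - (of_real \<gamma> / (1 - z)) - cnj z * 1 / of_real (1 - r\<^sup>2)"
      using pre_schwarzian_harmonic[OF rep z] h'[OF z] k0[OF z] h''[OF z] \<omega>[OF z] \<omega>'[OF z] cz
      by simp
    \<comment> \<open>On the real radius [0, 1) both terms are real and nonpositive, so their moduli
      add without cancellation.\<close>
    also have "\<dots> = - of_real (\<gamma> / (1 - r) + r / (1 - r\<^sup>2))"
      by (simp add: z_def)
    finally have "cmod (pre_schwarzian f z) = \<bar>\<gamma> / (1 - r) + r / (1 - r\<^sup>2)\<bar>"
      by (simp only: norm_minus_cancel norm_of_real)
    also have "\<dots> = \<gamma> / (1 - r) + r / (1 - r\<^sup>2)"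
      using r r2 assms by (intro abs_of_nonneg add_nonneg_nonneg divide_nonneg_nonneg) auto
    finally have "(1 - (cmod z)\<^sup>2) * cmod (pre_schwarzian f z) =
        (1 - r\<^sup>2) * (\<gamma> / (1 - r)) + (1 - r\<^sup>2) * (r / (1 - r\<^sup>2))"
      by (simp only: cz distrib_left)
    also have "(1 - r\<^sup>2) * (\<gamma> / (1 - r)) = \<gamma> * (1 + r)"
      using r by (simp add: power2_eq_square field_simps)
    also have "(1 - r\<^sup>2) * (r / (1 - r\<^sup>2)) = r"
      using r2 by simp
    finally show ?thesis
      unfolding pre_schwarzian_norm_def using z
      by (intro SUP_upper2[of z]) auto
  qed
  show ?thesis
    using HC bound by (rule that)
qed

theorem theorem2p3:
  fixes \<theta> \<gamma> :: real
  assumes "\<bar>\<theta>\<bar> < pi / 2" and "\<gamma> > 0"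
  shows "(\<forall>f \<in> HC \<theta> \<gamma>. pre_schwarzian_norm f \<le> ereal (1 + 2 * \<gamma> * cos \<theta>)) \<and>
         (\<forall>C::real. C < 1 + 2 * \<gamma> \<longrightarrow> \<not> (\<forall>f \<in> HC 0 \<gamma>. pre_schwarzian_norm f \<le> ereal C))"
proof (intro conjI ballI allI impI notI)
  show "pre_schwarzian_norm f \<le> ereal (1 + 2 * \<gamma> * cos \<theta>)" if "f \<in> HC \<theta> \<gamma>" for f
    using pre_schwarzian_norm_le[OF assms that] .
next
  fix C :: real
  assume C: "C < 1 + 2 * \<gamma>" and all: "\<forall>f \<in> HC 0 \<gamma>. pre_schwarzian_norm f \<le> ereal C"
  obtain f where f: "f \<in> HC 0 \<gamma>"
    and ge: "\<And>r. 0 \<le> r \<Longrightarrow> r < 1 \<Longrightarrow> ereal (\<gamma> * (1 + r) + r) \<le> pre_schwarzian_norm f"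
    using HC_extremal[OF assms(2)] by blast
  \<comment> \<open>The value 1 + 2\<gamma> is only approached, so the bound by \<open>C\<close> is
    passed to the limit r -> 1 from the left.\<close>
  have "\<gamma> * (1 + r) + r \<le> C" if "0 \<le> r" "r < 1" for r :: real
    using order_trans[OF ge[OF that]] all f by fastforce
  moreover have "((\<lambda>r. \<gamma> * (1 + r) + r) \<longlongrightarrow> \<gamma> * (1 + 1) + 1) (at_left (1::real))"
    by (intro tendsto_intros)
  moreover have "eventually (\<lambda>r. 0 \<le> r \<and> r < 1) (at_left (1::real))"
    by (auto simp: eventually_at_left_field intro!: exI[of _ 0])
  ultimately have "\<gamma> * (1 + 1) + 1 \<le> C"
    by (intro tendsto_upperbound[of _ _ "at_left (1::real)"]) (auto elim!: eventually_mono)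
  with C show False by simp
qed

end
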